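(* Let $k$ be a (commutative) field and let $R$ be a $k$-algebra such that $\dim_k R<|k|$ (as cardinal numbers). Then for any left ideal $I$ of $R$, $\sqrt[\mathrm{j}]{I}$ is the largest left ideal of $R$ that is integral over $I$. In particular, $\sqrt[\mathrm{i}]{I}=\sqrt[\mathrm{j}]{I}$.
   Context: Rings and algebras are associative and unital, not necessarily commutative. Let $I$ be a left ideal of $R$. The Jacobson radical $\sqrt[\mathrm{j}]{I}$ of $I$ is the intersection of all maximal left ideals of $R$ containing $I$ (so it is $R$ when $I=R$). An element $a\in R$ is integral over $I$ if there exist $n\ge1$ and $r_0,\dots,r_{n-1}\in I$ with $a^n+r_{n-1}a^{n-1}+\cdots+r_1a+r_0=0$; a subset of $R$ is integral over $I$ if each of its elements is. A left ideal $J$ is integrally closed if no left ideal of $R$ properly containing $J$ is integral over $J$. The integral radical $\sqrt[\mathrm{i}]{I}$ is the intersection of all integrally closed left ideals of $R$ containing $I$. *)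

theory Defs
  imports Complex_Main
begin

unbundle cardinal_syntax

text \<open>
  Unital associative, not necessarily commutative, rings are types of sort
  \<open>{ring, monoid_mult}\<close>; unlike \<open>ring_1\<close>, this sort does not
  require \<open>0 \<noteq> 1\<close>, so the zero ring is included.
\<close>

locale k_algebra = vector_space scale
  for scale :: "'k::field \<Rightarrow> 'r::{ring, monoid_mult} \<Rightarrow> 'r" +
  assumes scale_mult_left: "scale c x * y = scale c (x * y)"
    and scale_mult_right: "x * scale c y = scale c (x * y)"

context k_algebra
begin

definition is_basis :: "'r set \<Rightarrow> bool" where
  "is_basis B \<longleftrightarrow> independent B \<and> span B = UNIV"

text \<open>
  The dimension of the algebra as a cardinal, in contrast to the
  \<open>nat\<close>-valued \<open>dim\<close> of the library, which is 0 on spaces of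
  infinite dimension. By the lemma \<open>card_of_basis\<close> below it does not
  depend on the chosen basis.
\<close>

definition cardinal_dim :: "'r rel" where
  "cardinal_dim = |SOME B. is_basis B|"

lemma is_basis_exists: "\<exists>B. is_basis B"
  unfolding is_basis_def by (rule maximal_independent_subset[of UNIV]) blast

lemma basis_ordLeq_basis:
  assumes B: "is_basis B" and C: "is_basis C"
  shows "|B| \<le>o |C|"
proof (cases "finite C")
  case True
  then have "finite B \<and> card B \<le> card C"
    using independent_span_bound[of C B] B C by (auto simp: is_basis_def)
  then show ?thesis
    using True by (metis card_of_ordLeq inj_on_iff_card_le)
next
  case False
  have "\<exists>S. finite S \<and> S \<subseteq> B \<and> c \<in> span S" for c
  proof -
    have "c \<in> span B" using B by (simp add: is_basis_def)
    then show ?thesis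
      unfolding span_explicit[of B]
      by (auto intro!: span_sum span_scale intro: span_base)
  qed
  then obtain S where S: "\<And>c. finite (S c)" "\<And>c. S c \<subseteq> B" "\<And>c. c \<in> span (S c)"
    by metis
  let ?U = "\<Union>c\<in>C. S c"
  have "C \<subseteq> span ?U"
    using S(3) span_mono[of "S _" ?U] by blast
  then have "span C \<subseteq> span ?U"
    by (rule span_minimal) simp
  then have U: "span ?U = UNIV"
    using C by (auto simp: is_basis_def)
  have "B \<subseteq> ?U"
  proof
    fix b assume b: "b \<in> B"
    show "b \<in> ?U"
    proof (rule ccontr)
      assume "b \<notin> ?U"
      then have "?U \<subseteq> B - {b}" using S(2) by blast
      then have "b \<in> span (B - {b})" using U span_mono by blast
      then show False using B b by (auto simp: is_basis_def dependent_def)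
    qed
  qed
  then have "|B| \<le>o |?U|" by (rule card_of_mono1)
  also have "|?U| \<le>o |C|"
  proof (rule card_of_UNION_ordLeq_infinite[OF False])
    show "\<forall>c\<in>C. |S c| \<le>o |C|"
      using S(1) False by (meson card_of_Well_order card_of_ordLeq_finite ordLeq_total)
  qed (rule card_of_mono1[OF subset_refl])
  finally (ordLeq_transitive) show ?thesis .
qed

lemma card_of_basis: "is_basis B \<Longrightarrow> |B| =o cardinal_dim"
  unfolding cardinal_dim_def
  by (metis basis_ordLeq_basis is_basis_exists someI_ex ordIso_iff_ordLeq)

end

definition left_ideal :: "'r::{ring, monoid_mult} set \<Rightarrow> bool" where
  "left_ideal I \<longleftrightarrow>
     0 \<in> I \<and> (\<forall>x\<in>I. \<forall>y\<in>I. x + y \<in> I) \<and> (\<forall>r. \<forall>x\<in>I. r * x \<in> I)"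

definition maximal_left_ideal :: "'r::{ring, monoid_mult} set \<Rightarrow> bool" where
  "maximal_left_ideal M \<longleftrightarrow>
     left_ideal M \<and> M \<noteq> UNIV \<and> (\<forall>J. left_ideal J \<and> M \<subseteq> J \<longrightarrow> J = M \<or> J = UNIV)"

definition jacobson_radical :: "'r::{ring, monoid_mult} set \<Rightarrow> 'r set" where
  "jacobson_radical I = \<Inter> {M. maximal_left_ideal M \<and> I \<subseteq> M}"

definition integral_elt :: "'r::{ring, monoid_mult} set \<Rightarrow> 'r \<Rightarrow> bool" where
  "integral_elt I a \<longleftrightarrow>
     (\<exists>n\<ge>1. \<exists>r :: nat \<Rightarrow> 'r. (\<forall>i<n. r i \<in> I) \<and> a ^ n + (\<Sum>i<n. r i * a ^ i) = 0)"

definition integral_over :: "'r::{ring, monoid_mult} set \<Rightarrow> 'r set \<Rightarrow> bool" where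
  "integral_over I S \<longleftrightarrow> (\<forall>a\<in>S. integral_elt I a)"

definition integrally_closed :: "'r::{ring, monoid_mult} set \<Rightarrow> bool" where
  "integrally_closed J \<longleftrightarrow>
     left_ideal J \<and> \<not> (\<exists>L. left_ideal L \<and> J \<subset> L \<and> integral_over J L)"

definition integral_radical :: "'r::{ring, monoid_mult} set \<Rightarrow> 'r set" where
  "integral_radical I = \<Inter> {J. integrally_closed J \<and> I \<subseteq> J}"

end

theory Submission
  imports Defs "HOL-Computational_Algebra.Polynomial"
begin

text \<open>
  One inclusion holds in every ring. If a left ideal \<open>L\<close> is integral over \<open>I\<close> and
  \<open>M \<supseteq> I\<close> is maximal with \<open>\<not> L \<subseteq> M\<close>, then \<open>L + M = R\<close>, so \<open>L\<close>
  contains some \<open>1 - m\<close> with \<open>m \<in> M\<close>. Modulo \<open>M\<close> all powers of \<open>1 - m\<close> are \<open>1\<close>, so an integral equation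
  for \<open>1 - m\<close> over \<open>I\<close> reduces to \<open>1 \<in> M\<close>
  (\<open>integral_subset_jacobson_radical\<close>).

  The other inclusion, that every \<open>a\<close> in the Jacobson radical of \<open>I\<close> is integral over
  \<open>I\<close>, is a relative form of Amitsur's argument for algebras of small dimension. For every
  \<open>r\<close> the element \<open>1 - r a\<close> generates \<open>R\<close> together with \<open>I\<close>; so for each
  scalar \<open>c\<close> there are \<open>s\<^sub>c \<in> R\<close> and \<open>i\<^sub>c \<in> I\<close> with
  \<open>s\<^sub>c (1 - c a) + i\<^sub>c = 1\<close>. As there are more scalars than the dimension of \<open>R\<close>,
  there is a nontrivial relation \<open>\<Sum> \<lambda>\<^sub>c s\<^sub>c = 0\<close> with finitely many terms
  (\<open>family_dependent\<close>). Multiplying it on the right by \<open>\<Prod> (1 - c a)\<close> clears the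
  denominators and gives \<open>p(a) \<in> N\<close>, where
  \<open>p = \<Sum>\<^sub>c \<lambda>\<^sub>c \<Prod>\<^bsub>d \<noteq> c\<^esub> (1 - d t)\<close> is a nonzero polynomial and
  \<open>N = \<Sum>\<^sub>j I a\<^sup>j\<close>, a left ideal stable under right multiplication by \<open>a\<close>.
  Write \<open>p = t\<^sup>e q\<close> with \<open>q(0) \<noteq> 0\<close>. Up to a scalar, \<open>q(a)\<close> again has the form
  \<open>1 - r a\<close>, hence is left invertible modulo \<open>I\<close>, and therefore \<open>a\<^sup>e \<in> N\<close>
  (\<open>power_in_of_polynomial_in\<close>). Multiplying by a power of \<open>a\<close> on the left, which does not
  raise the degrees in \<open>a\<close> of elements of \<open>N\<close>, turns this into an integral equation.

  Finally, the Jacobson radical is idempotent, so by the first inclusion it is integrally closed;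
  and by the second one an integrally closed left ideal equals its own Jacobson radical. This
  identifies the two radicals.
\<close>

section \<open>Left ideals and maximal left ideals\<close>

lemma left_ideal_zero: "left_ideal I \<Longrightarrow> 0 \<in> I"
  and left_ideal_add: "left_ideal I \<Longrightarrow> x \<in> I \<Longrightarrow> y \<in> I \<Longrightarrow> x + y \<in> I"
  and left_ideal_mult: "left_ideal I \<Longrightarrow> x \<in> I \<Longrightarrow> r * x \<in> I"
  by (auto simp: left_ideal_def)

lemma left_ideal_uminus:
  assumes "left_ideal I" "x \<in> I"
  shows "- x \<in> I"
  using left_ideal_mult[OF assms, of "- 1"] by simp

lemma left_ideal_diff: "left_ideal I \<Longrightarrow> x \<in> I \<Longrightarrow> y \<in> I \<Longrightarrow> x - y \<in> I"
  using left_ideal_add[of I x "- y"] left_ideal_uminus[of I y] by simp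

lemma left_ideal_sum:
  assumes "left_ideal I" "\<And>x. x \<in> A \<Longrightarrow> f x \<in> I"
  shows "sum f A \<in> I"
  using assms(2)
  by (induction A rule: infinite_finite_induct)
     (auto intro: left_ideal_zero left_ideal_add assms(1))

lemma left_ideal_eq_UNIV:
  assumes "left_ideal I" "1 \<in> I"
  shows "I = UNIV"
  using left_ideal_mult[OF assms] by auto

lemma left_ideal_adjoin:
  assumes I: "left_ideal I"
  shows "left_ideal {s * x + i | s i. i \<in> I}"
    and "I \<subseteq> {s * x + i | s i. i \<in> I}"
    and "x \<in> {s * x + i | s i. i \<in> I}"
proof -
  let ?L = "{s * x + i | s i. i \<in> I}"
  have "0 \<in> ?L"
    using left_ideal_zero[OF I] by (auto intro!: exI[of _ 0])
  moreover have "u + v \<in> ?L" if uv: "u \<in> ?L" "v \<in> ?L" for u v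
  proof -
    obtain s i t j where "u = s * x + i" "v = t * x + j" "i \<in> I" "j \<in> I"
      using uv by auto
    then have "u + v = (s + t) * x + (i + j)" "i + j \<in> I"
      using left_ideal_add[OF I] by (auto simp: algebra_simps)
    then show ?thesis by blast
  qed
  moreover have "r * u \<in> ?L" if u: "u \<in> ?L" for r u
  proof -
    obtain s i where "u = s * x + i" "i \<in> I"
      using u by auto
    then have "r * u = (r * s) * x + r * i" "r * i \<in> I"
      using left_ideal_mult[OF I] by (auto simp: algebra_simps)
    then show ?thesis by blast
  qed
  ultimately show "left_ideal ?L"
    unfolding left_ideal_def by blast
  have "i = 0 * x + i" for i
    by simp
  then show "I \<subseteq> ?L"
    by blast
  have "x = 1 * x + 0"
    by simp
  then show "x \<in> ?L"
    using left_ideal_zero[OF I] by blast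
qed

text \<open>
  Zorn's lemma applies because properness of a left ideal means \<open>1 \<notin> I\<close>, a condition
  inherited by unions of chains.
\<close>

lemma exists_maximal_left_ideal:
  assumes I: "left_ideal I" and proper: "1 \<notin> I"
  shows "\<exists>M. maximal_left_ideal M \<and> I \<subseteq> M"
proof -
  let ?A = "{J. left_ideal J \<and> I \<subseteq> J \<and> 1 \<notin> J}"
  have "\<exists>U\<in>?A. \<forall>X\<in>C. X \<subseteq> U" if C: "subset.chain ?A C" for C
  proof (cases "C = {}")
    case True
    then show ?thesis using I proper by blast
  next
    case False
    have CA: "C \<subseteq> ?A" and chain: "\<And>X Y. X \<in> C \<Longrightarrow> Y \<in> C \<Longrightarrow> X \<subseteq> Y \<or> Y \<subseteq> X"
      using C by (auto simp: subset_chain_def)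
    have "x + y \<in> \<Union>C" if xy: "x \<in> \<Union>C" "y \<in> \<Union>C" for x y
    proof -
      obtain X Y where XY: "X \<in> C" "x \<in> X" "Y \<in> C" "y \<in> Y"
        using xy by blast
      with chain obtain Z where "Z \<in> C" "x \<in> Z" "y \<in> Z"
        by blast
      then show ?thesis
        using CA by (blast intro: left_ideal_add)
    qed
    moreover have "r * x \<in> \<Union>C" if "x \<in> \<Union>C" for r x
      using that CA by (blast intro: left_ideal_mult)
    moreover have "0 \<in> \<Union>C"
      using False CA by (blast intro: left_ideal_zero)
    ultimately have "left_ideal (\<Union>C)"
      unfolding left_ideal_def by blast
    then have "\<Union>C \<in> ?A"
      using False CA by blast
    then show ?thesis by blast
  qed
  from subset_Zorn[OF this] obtain M
    where M: "M \<in> ?A" and max: "\<forall>X\<in>?A. M \<subseteq> X \<longrightarrow> X = M"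
    by auto
  have "J = M \<or> J = UNIV" if "left_ideal J" "M \<subseteq> J" for J
    using that M max left_ideal_eq_UNIV[of J] by blast
  then have "maximal_left_ideal M"
    using M unfolding maximal_left_ideal_def by blast
  then show ?thesis
    using M by blast
qed

section \<open>The Jacobson radical of a left ideal\<close>

lemma left_ideal_jacobson_radical: "left_ideal (jacobson_radical I)"
  by (auto simp: jacobson_radical_def maximal_left_ideal_def left_ideal_def)

lemma subset_jacobson_radical: "I \<subseteq> jacobson_radical I"
  by (auto simp: jacobson_radical_def)

lemma jacobson_radical_mono: "I \<subseteq> J \<Longrightarrow> jacobson_radical I \<subseteq> jacobson_radical J"
  by (auto simp: jacobson_radical_def)

lemma jacobson_radical_idem: "jacobson_radical (jacobson_radical I) = jacobson_radical I"
  by (auto simp: jacobson_radical_def)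

text \<open>
  A maximal left ideal containing \<open>I\<close> contains \<open>r a\<close>, so it cannot contain
  \<open>1 - r a\<close> as well.
\<close>

lemma jacobson_radical_left_invertible:
  assumes I: "left_ideal I" and a: "a \<in> jacobson_radical I"
  shows "\<exists>s. \<exists>i\<in>I. s * (1 - r * a) + i = 1"
proof (rule ccontr)
  assume none: "\<not> ?thesis"
  let ?L = "{s * (1 - r * a) + i | s i. i \<in> I}"
  note L = left_ideal_adjoin[OF I, of "1 - r * a"]
  have "1 \<notin> ?L"
    using none by force
  then obtain M where M: "maximal_left_ideal M" "?L \<subseteq> M"
    using exists_maximal_left_ideal[OF L(1)] by blast
  have lM: "left_ideal M" and proper: "M \<noteq> UNIV"
    using M(1) by (auto simp: maximal_left_ideal_def)
  have "a \<in> M"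
    using a M L(2) unfolding jacobson_radical_def by blast
  then have "r * a \<in> M"
    by (rule left_ideal_mult[OF lM])
  moreover have "1 - r * a \<in> M"
    using M(2) L(3) by blast
  ultimately have "(1 - r * a) + r * a \<in> M"
    by (intro left_ideal_add[OF lM])
  then show False
    using left_ideal_eq_UNIV[OF lM] proper by simp
qed

lemma power_one_minus_cong_one:
  assumes M: "left_ideal M" and m: "m \<in> M"
  shows "(1 - m) ^ n - 1 \<in> M"
proof (induction n)
  case 0
  then show ?case using left_ideal_zero[OF M] by simp
next
  case (Suc n)
  have "(1 - m) ^ Suc n - 1 = ((1 - m) ^ n - 1) - (1 - m) ^ n * m"
    by (simp only: power_Suc2 right_diff_distrib mult_1_right) (simp add: algebra_simps)
  then show ?case
    using left_ideal_diff[OF M Suc.IH left_ideal_mult[OF M m]] by (simp only:)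
qed

lemma integral_subset_jacobson_radical:
  assumes L: "left_ideal L" and int: "integral_over I L"
  shows "L \<subseteq> jacobson_radical I"
  unfolding jacobson_radical_def
proof (clarify, rule ccontr)
  fix l M
  assume l: "l \<in> L" "l \<notin> M" and max: "maximal_left_ideal M" and IM: "I \<subseteq> M"
  have M: "left_ideal M" and proper: "M \<noteq> UNIV"
    using max by (auto simp: maximal_left_ideal_def)
  note A = left_ideal_adjoin[OF M, of l]
  have "{s * l + i | s i. i \<in> M} = UNIV"
    using max A l unfolding maximal_left_ideal_def by blast
  then have "1 \<in> {s * l + i | s i. i \<in> M}"
    by simp
  then obtain s m where m: "1 = s * l + m" "m \<in> M"
    by blast
  then have "1 - m = s * l"
    by (simp add: eq_diff_eq diff_eq_eq)
  then have "1 - m \<in> L"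
    using left_ideal_mult[OF L l(1)] by simp
  then obtain n r where r: "\<forall>i<n. r i \<in> I"
    and eq: "(1 - m) ^ n + (\<Sum>i<n. r i * (1 - m) ^ i) = 0"
    using int unfolding integral_over_def integral_elt_def by blast
  note pow = power_one_minus_cong_one[OF M m(2)]
  have "r i * (1 - m) ^ i \<in> M" if "i < n" for i
  proof -
    have "r i \<in> M"
      using r that IM by blast
    then have "r i * ((1 - m) ^ i - 1) + r i \<in> M"
      by (intro left_ideal_add[OF M] left_ideal_mult[OF M pow])
    then show ?thesis
      by (simp add: right_diff_distrib)
  qed
  then have "(\<Sum>i<n. r i * (1 - m) ^ i) \<in> M"
    by (intro left_ideal_sum[OF M]) auto
  moreover have "(1 - m) ^ n = - (\<Sum>i<n. r i * (1 - m) ^ i)"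
    using eq by (simp add: eq_neg_iff_add_eq_0)
  ultimately have "(1 - m) ^ n \<in> M"
    using left_ideal_uminus[OF M] by simp
  then have "(1 - m) ^ n - ((1 - m) ^ n - 1) \<in> M"
    by (rule left_ideal_diff[OF M _ pow])
  then have "1 \<in> M"
    by simp
  then show False
    using left_ideal_eq_UNIV[OF M] proper by blast
qed

section \<open>Polynomial expressions with coefficients in a left ideal\<close>

definition left_poly_upto :: "'r::{ring, monoid_mult} set \<Rightarrow> 'r \<Rightarrow> nat \<Rightarrow> 'r set" where
  "left_poly_upto I a m = {\<Sum>i<m. r i * a ^ i | r. \<forall>i. r i \<in> I}"

definition left_poly :: "'r::{ring, monoid_mult} set \<Rightarrow> 'r \<Rightarrow> 'r set" where
  "left_poly I a = (\<Union>m. left_poly_upto I a m)"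

lemma left_ideal_left_poly_upto:
  assumes I: "left_ideal I"
  shows "left_ideal (left_poly_upto I a m)"
proof -
  let ?N = "left_poly_upto I a m"
  have "0 \<in> ?N"
    unfolding left_poly_upto_def
    by (auto intro!: exI[of _ "\<lambda>_. 0"] simp: left_ideal_zero[OF I])
  moreover have "x + y \<in> ?N" if xy: "x \<in> ?N" "y \<in> ?N" for x y
  proof -
    obtain r s where "x = (\<Sum>i<m. r i * a ^ i)" "y = (\<Sum>i<m. s i * a ^ i)"
      and rs: "\<forall>i. r i \<in> I" "\<forall>i. s i \<in> I"
      using xy unfolding left_poly_upto_def by blast
    then have "x + y = (\<Sum>i<m. (r i + s i) * a ^ i)"
      by (simp add: sum.distrib distrib_right)
    moreover have "\<forall>i. r i + s i \<in> I"
      using rs left_ideal_add[OF I] by blast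
    ultimately show ?thesis
      unfolding left_poly_upto_def by (intro CollectI exI[of _ "\<lambda>i. r i + s i"]) simp
  qed
  moreover have "u * x \<in> ?N" if x: "x \<in> ?N" for u x
  proof -
    obtain r where "x = (\<Sum>i<m. r i * a ^ i)" and r: "\<forall>i. r i \<in> I"
      using x unfolding left_poly_upto_def by blast
    then have "u * x = (\<Sum>i<m. (u * r i) * a ^ i)"
      by (simp add: sum_distrib_left mult.assoc)
    moreover have "\<forall>i. u * r i \<in> I"
      using r left_ideal_mult[OF I] by blast
    ultimately show ?thesis
      unfolding left_poly_upto_def by (intro CollectI exI[of _ "\<lambda>i. u * r i"]) simp
  qed
  ultimately show ?thesis
    unfolding left_ideal_def by blast
qed

lemma left_poly_upto_mono:
  assumes I: "left_ideal I" and "m \<le> n"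
  shows "left_poly_upto I a m \<subseteq> left_poly_upto I a n"
proof
  fix x assume "x \<in> left_poly_upto I a m"
  then obtain r where x: "x = (\<Sum>i<m. r i * a ^ i)" and r: "\<forall>i. r i \<in> I"
    unfolding left_poly_upto_def by blast
  let ?r = "\<lambda>i. if i < m then r i else 0"
  have "x = (\<Sum>i<n. ?r i * a ^ i)"
    unfolding x using \<open>m \<le> n\<close> by (intro sum.mono_neutral_cong_left) auto
  moreover have "\<forall>i. ?r i \<in> I"
    using r left_ideal_zero[OF I] by simp
  ultimately show "x \<in> left_poly_upto I a n"
    unfolding left_poly_upto_def by (intro CollectI exI[of _ ?r] conjI)
qed

lemma left_ideal_left_poly:
  assumes I: "left_ideal I"
  shows "left_ideal (left_poly I a)"
proof -
  note N = left_ideal_left_poly_upto[OF I, of a]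
  have "x + y \<in> left_poly I a" if xy: "x \<in> left_poly I a" "y \<in> left_poly I a" for x y
  proof -
    obtain m n where "x \<in> left_poly_upto I a m" "y \<in> left_poly_upto I a n"
      using xy unfolding left_poly_def by blast
    then have "x \<in> left_poly_upto I a (max m n)" "y \<in> left_poly_upto I a (max m n)"
      using left_poly_upto_mono[OF I] by (metis max.cobounded1 max.cobounded2 subsetD)+
    then show ?thesis
      unfolding left_poly_def by (auto intro: left_ideal_add[OF N])
  qed
  moreover have "0 \<in> left_poly I a"
    by (simp add: left_poly_def left_ideal_zero[OF N])
  moreover have "r * x \<in> left_poly I a" if "x \<in> left_poly I a" for r x
    using that by (auto simp: left_poly_def intro: left_ideal_mult[OF N])
  ultimately show ?thesis
    unfolding left_ideal_def by blast
qed

lemma subset_left_poly: "I \<subseteq> left_poly I a"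
proof
  fix x assume "x \<in> I"
  then have "x \<in> left_poly_upto I a 1"
    unfolding left_poly_upto_def by (intro CollectI exI[of _ "\<lambda>_. x"]) simp
  then show "x \<in> left_poly I a"
    unfolding left_poly_def by blast
qed

lemma left_poly_mult_right:
  assumes I: "left_ideal I" and x: "x \<in> left_poly I a"
  shows "x * a \<in> left_poly I a"
proof -
  obtain m r where x: "x = (\<Sum>i<m. r i * a ^ i)" and r: "\<forall>i. r i \<in> I"
    using x unfolding left_poly_def left_poly_upto_def by blast
  let ?r = "\<lambda>i. case i of 0 \<Rightarrow> 0 | Suc j \<Rightarrow> r j"
  have "x * a = (\<Sum>i<m. r i * a ^ Suc i)"
    unfolding x by (simp only: sum_distrib_right mult.assoc power_Suc2)
  also have "\<dots> = (\<Sum>i<Suc m. ?r i * a ^ i)"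
    by (simp add: sum.lessThan_Suc_shift del: sum.lessThan_Suc)
  finally have "x * a = (\<Sum>i<Suc m. ?r i * a ^ i)" .
  moreover have "\<forall>i. ?r i \<in> I"
    using r left_ideal_zero[OF I] by (auto split: nat.split)
  ultimately have "x * a \<in> left_poly_upto I a (Suc m)"
    unfolding left_poly_upto_def by blast
  then show ?thesis
    unfolding left_poly_def by blast
qed

text \<open>
  Left multiplication by \<open>a\<close> raises the exponent of \<open>a\<^sup>e\<close>, but on an expression
  \<open>\<Sum> r\<^sub>i a\<^sup>i\<close> it only changes the coefficients, because \<open>I\<close> is a left ideal. So
  the exponent on the left can be made to exceed the degrees on the right.
\<close>

lemma integral_elt_of_power_in_left_poly:
  assumes I: "left_ideal I" and "a ^ e \<in> left_poly I a"
  shows "integral_elt I a"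
proof -
  obtain m where "a ^ e \<in> left_poly_upto I a m"
    using assms(2) unfolding left_poly_def by blast
  \<comment> \<open>An integral equation has positive degree, whence the \<open>1\<close>.\<close>
  moreover define n where "n = max 1 (max m e)"
  ultimately have "a ^ e \<in> left_poly_upto I a n"
    using left_poly_upto_mono[OF I, of m n a] by (auto simp: le_max_iff_disj)
  then have "a ^ (n - e) * a ^ e \<in> left_poly_upto I a n"
    by (rule left_ideal_mult[OF left_ideal_left_poly_upto[OF I]])
  then have "a ^ n \<in> left_poly_upto I a n"
    by (simp add: n_def flip: power_add)
  then obtain r where "a ^ n = (\<Sum>i<n. r i * a ^ i)" and r: "\<forall>i. r i \<in> I"
    unfolding left_poly_upto_def by blast
  then have "a ^ n + (\<Sum>i<n. (- r i) * a ^ i) = 0"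
    by (simp add: sum_negf)
  moreover have "\<forall>i<n. - r i \<in> I"
    using r left_ideal_uminus[OF I] by blast
  moreover have "n \<ge> 1"
    by (simp add: n_def)
  ultimately show ?thesis
    unfolding integral_elt_def by (intro exI[of _ n] conjI exI[of _ "\<lambda>i. - r i"])
qed

section \<open>Evaluating polynomials in an algebra\<close>

context k_algebra
begin

text \<open>
  Horner's scheme, as for \<open>poly\<close>, which itself only evaluates at points of the
  coefficient ring.
\<close>

definition eval_poly :: "'r \<Rightarrow> 'k poly \<Rightarrow> 'r" where
  "eval_poly a p = fold_coeffs (\<lambda>c x. scale c 1 + a * x) p 0"

lemma eval_poly_0 [simp]: "eval_poly a 0 = 0"
  by (simp add: eval_poly_def)

lemma eval_poly_pCons [simp]: "eval_poly a (pCons c p) = scale c 1 + a * eval_poly a p"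
  by (cases "p = 0 \<and> c = 0") (auto simp: eval_poly_def)

lemma eval_poly_add: "eval_poly a (p + q) = eval_poly a p + eval_poly a q"
  by (induction p q rule: poly_induct2) (simp_all add: algebra_simps scale_left_distrib)

lemma eval_poly_smult: "eval_poly a (smult c p) = scale c (eval_poly a p)"
  by (induction p) (simp_all add: scale_right_distrib scale_mult_right)

lemma eval_poly_mult: "eval_poly a (p * q) = eval_poly a p * eval_poly a q"
  by (induction p)
     (simp_all add: eval_poly_add eval_poly_smult scale_mult_left distrib_right mult.assoc)

lemma eval_poly_sum: "eval_poly a (sum f A) = (\<Sum>x\<in>A. eval_poly a (f x))"
  by (induction A rule: infinite_finite_induct) (simp_all add: eval_poly_add)

lemma eval_poly_X_power: "eval_poly a ([:0, 1:] ^ n) = a ^ n"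
  by (induction n) (simp_all add: eval_poly_mult one_pCons)

lemma eval_poly_commute: "eval_poly a p * eval_poly a q = eval_poly a q * eval_poly a p"
  by (metis eval_poly_mult mult.commute)

lemma left_ideal_scale:
  assumes "left_ideal N" "x \<in> N"
  shows "scale c x \<in> N"
  using left_ideal_mult[OF assms, of "scale c 1"] by (simp add: scale_mult_left)

lemma mult_eval_poly_closed:
  assumes N: "left_ideal N" and right: "\<And>x. x \<in> N \<Longrightarrow> x * a \<in> N" and "x \<in> N"
  shows "x * eval_poly a p \<in> N"
  using \<open>x \<in> N\<close>
proof (induction p arbitrary: x)
  case 0
  then show ?case using left_ideal_zero[OF N] by simp
next
  case (pCons c p)
  have "scale c x + (x * a) * eval_poly a p \<in> N"
    by (intro left_ideal_add[OF N] left_ideal_scale[OF N] pCons.IH right pCons.prems)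
  then show ?case
    by (simp add: distrib_left scale_mult_right mult.assoc)
qed

section \<open>Elements of the Jacobson radical are integral\<close>

text \<open>
  The vanishing order of \<open>p\<close> at \<open>0\<close> is a suitable exponent: the cofactor \<open>q\<close> has
  nonzero constant term \<open>b\<close>, so \<open>b\<^sup>-\<^sup>1 q(a)\<close> has the form \<open>1 - r a\<close> and can be
  cancelled modulo \<open>I\<close>. The error term \<open>i a\<^sup>e\<close> with \<open>i \<in> I\<close> is absorbed by
  stability of \<open>N\<close> under right multiplication by \<open>a\<close>.
\<close>

lemma power_in_of_polynomial_in:
  assumes N: "left_ideal N" and right: "\<And>x. x \<in> N \<Longrightarrow> x * a \<in> N" and IN: "I \<subseteq> N"
    and inv: "\<And>r. \<exists>s. \<exists>i\<in>I. s * (1 - r * a) + i = 1"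
    and "p \<noteq> 0" and p: "eval_poly a p \<in> N"
  shows "\<exists>e. a ^ e \<in> N"
proof -
  define e where "e = order 0 p"
  obtain q where q: "p = [:0, 1:] ^ e * q" "\<not> [:0, 1:] dvd q"
    using order_decomp[OF \<open>p \<noteq> 0\<close>, of 0] by (auto simp: e_def)
  obtain b q' where q': "q = pCons b q'"
    by (cases q)
  have "b \<noteq> 0"
    using q(2) poly_eq_0_iff_dvd[of q 0] by (auto simp: q')
  let ?r = "- scale (inverse b) (eval_poly a q')"
  have "eval_poly a q' * a = a * eval_poly a q'"
    using eval_poly_commute[of a q' "[:0, 1:]"] by simp
  then have unit: "1 - ?r * a = scale (inverse b) (eval_poly a q)"
    using \<open>b \<noteq> 0\<close> by (simp add: q' scale_mult_left scale_right_distrib)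
  obtain s i where si: "i \<in> I" "s * scale (inverse b) (eval_poly a q) + i = 1"
    using inv[of ?r] unfolding unit by blast
  have "a ^ e = (s * scale (inverse b) (eval_poly a q) + i) * a ^ e"
    by (simp add: si(2))
  also have "\<dots> = s * scale (inverse b) (eval_poly a q * a ^ e) + i * a ^ e"
    by (simp add: distrib_right mult.assoc scale_mult_left)
  also have "eval_poly a q * a ^ e = eval_poly a p"
    by (metis q(1) eval_poly_X_power eval_poly_commute eval_poly_mult)
  finally have "a ^ e = s * scale (inverse b) (eval_poly a p) + i * a ^ e" .
  moreover have "i * a ^ e \<in> N"
    using mult_eval_poly_closed[OF N right, of i "[:0, 1:] ^ e"] si(1) IN
    by (auto simp: eval_poly_X_power)
  moreover have "s * scale (inverse b) (eval_poly a p) \<in> N"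
    by (intro left_ideal_mult[OF N] left_ideal_scale[OF N] p)
  ultimately show ?thesis
    by (metis left_ideal_add[OF N])
qed

text \<open>
  If the family is not injective, the difference of two equal
  members is a relation; otherwise its range is too large to be independent.
\<close>

lemma family_dependent:
  assumes dim: "cardinal_dim <o |UNIV :: 'k set|"
  fixes s :: "'k \<Rightarrow> 'r"
  shows "\<exists>S u. finite S \<and> (\<exists>c\<in>S. u c \<noteq> 0) \<and> (\<Sum>c\<in>S. scale (u c) (s c)) = 0"
proof (cases "inj s")
  case False
  then obtain c d where cd: "c \<noteq> d" "s c = s d"
    by (auto simp: inj_def)
  then show ?thesis
    by (intro exI[of _ "{c, d}"] exI[of _ "\<lambda>x. if x = c then 1 else - 1"]) auto
next
  case True
  have "dependent (range s)"
  proof (rule ccontr)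
    assume "independent (range s)"
    then obtain B where B: "range s \<subseteq> B" "independent B" "UNIV \<subseteq> span B"
      by (metis maximal_independent_subset_extend[OF subset_UNIV])
    have "|UNIV :: 'k set| \<le>o |range s|"
      using True by (intro card_of_ordLeq[THEN iffD1] exI[of _ s]) simp
    also have "|range s| \<le>o |B|"
      using B(1) by (rule card_of_mono1)
    also have "|B| =o cardinal_dim"
      using B by (intro card_of_basis) (auto simp: is_basis_def)
    finally have "|UNIV :: 'k set| \<le>o cardinal_dim"
      by this
    then show False
      using dim not_ordLess_ordLeq by blast
  qed
  then obtain T u where T: "finite T" "T \<subseteq> range s"
    and u: "\<exists>v\<in>T. u v \<noteq> 0" "(\<Sum>v\<in>T. scale (u v) v) = 0"
    unfolding dependent_explicit by blast
  have "finite (s -` T)"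
    using T(1) True by (rule finite_vimageI)
  moreover have "\<exists>c\<in>s -` T. u (s c) \<noteq> 0"
    using u(1) T(2) by blast
  moreover have "(\<Sum>c\<in>s -` T. scale (u (s c)) (s c)) = (\<Sum>v\<in>T. scale (u v) v)"
    using True T(2) by (intro sum.reindex_bij_betw) (auto simp: bij_betw_def inj_on_def)
  ultimately show ?thesis
    using u(2) by (intro exI[of _ "s -` T"] exI[of _ "\<lambda>c. u (s c)"]) simp
qed

text \<open>
  At \<open>1/c\<close> with \<open>c \<noteq> 0\<close> only the summand of \<open>c\<close> survives, as all others have
  the factor \<open>1 - c t\<close>. This covers all but the case where \<open>u\<close> is supported at \<open>0\<close>,
  in which the value at \<open>0\<close> is \<open>u 0\<close>.
\<close>

lemma sum_partial_products_nonzero: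
  fixes S :: "'k set"
  assumes S: "finite S" and c: "c \<in> S" "u c \<noteq> 0"
  shows "(\<Sum>c\<in>S. smult (u c) (\<Prod>d\<in>S - {c}. [:1, - d:])) \<noteq> 0"
proof
  define P where "P c = smult (u c) (\<Prod>d\<in>S - {c}. [:1, - d:])" for c
  assume "(\<Sum>c\<in>S. smult (u c) (\<Prod>d\<in>S - {c}. [:1, - d:])) = 0"
  then have zero: "(\<Sum>c\<in>S. P c) = 0"
    by (simp add: P_def)
  have poly_P: "poly (P c) t = u c * (\<Prod>d\<in>S - {c}. 1 - t * d)" for c t
    by (simp add: P_def poly_prod)
  have nz: "u d = 0" if d: "d \<in> S" "d \<noteq> 0" for d
  proof -
    have "poly (P c) (1 / d) = 0" if "c \<in> S - {d}" for c
      using that d S by (auto simp: poly_P)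
    then have "poly (\<Sum>c\<in>S. P c) (1 / d) = poly (P d) (1 / d)"
      using S d by (simp add: poly_sum sum.remove[of S d])
    moreover have "(\<Prod>x\<in>S - {d}. 1 - 1 / d * x) \<noteq> 0"
      using S d by (auto simp: field_simps)
    ultimately show ?thesis
      using zero by (simp add: poly_P)
  qed
  then have "c = 0"
    using c by blast
  have "poly (\<Sum>c\<in>S. P c) 0 = (\<Sum>c\<in>S. u c)"
    by (simp add: poly_sum poly_P)
  also have "\<dots> = u c"
    using nz S c \<open>c = 0\<close> by (simp add: sum.remove[of S c])
  finally show False
    using zero c(2) by simp
qed

lemma integral_over_jacobson_radical:
  fixes I :: "'r set"
  assumes dim: "cardinal_dim <o |UNIV :: 'k set|" and I: "left_ideal I"
  shows "integral_over I (jacobson_radical I)"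
  unfolding integral_over_def
proof
  fix a assume a: "a \<in> jacobson_radical I"
  note inv = jacobson_radical_left_invertible[OF I a]
  have "\<exists>s. \<exists>i\<in>I. s * (1 - scale c a) + i = 1" for c
    using inv[of "scale c 1"] by (simp add: scale_mult_left)
  then obtain s i where i: "\<And>c. i c \<in> I" and s: "\<And>c. s c * (1 - scale c a) + i c = 1"
    by metis
  obtain S u c0 where S: "finite S" and c0: "c0 \<in> S" "u c0 \<noteq> 0"
    and dep: "(\<Sum>c\<in>S. scale (u c) (s c)) = 0"
    using family_dependent[OF dim, of s] by blast
  define D where "D = (\<Prod>d\<in>S. [:1, - d:])"
  define Q where "Q c = (\<Prod>d\<in>S - {c}. [:1, - d:])" for c
  define p where "p = (\<Sum>c\<in>S. smult (u c) (Q c))"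
  let ?N = "left_poly I a"
  note N = left_ideal_left_poly[OF I, of a]
  note right = left_poly_mult_right[OF I, of _ a]
  have sD: "s c * eval_poly a D = eval_poly a (Q c) - i c * eval_poly a (Q c)" if "c \<in> S" for c
  proof -
    have "D = [:1, - c:] * Q c"
      unfolding D_def Q_def using S that by (rule prod.remove)
    then have "eval_poly a D = (1 - scale c a) * eval_poly a (Q c)"
      using eval_poly_mult[of a "[:1, - c:]" "Q c"] by (simp add: scale_mult_right)
    then have "s c * eval_poly a D = (s c * (1 - scale c a)) * eval_poly a (Q c)"
      by (simp add: mult.assoc)
    also have "s c * (1 - scale c a) = 1 - i c"
      using s[of c] by (simp add: eq_diff_eq)
    finally show ?thesis
      by (simp add: left_diff_distrib)
  qed
  have "0 = (\<Sum>c\<in>S. scale (u c) (s c)) * eval_poly a D"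
    by (simp add: dep)
  also have "\<dots> = (\<Sum>c\<in>S. scale (u c) (s c * eval_poly a D))"
    by (simp add: sum_distrib_right scale_mult_left)
  also have "\<dots> = eval_poly a p - (\<Sum>c\<in>S. scale (u c) (i c * eval_poly a (Q c)))"
    by (simp add: sD p_def eval_poly_sum eval_poly_smult scale_right_diff_distrib sum_subtractf)
  finally have "eval_poly a p = (\<Sum>c\<in>S. scale (u c) (i c * eval_poly a (Q c)))"
    by simp
  also have "\<dots> \<in> ?N"
    using i subset_left_poly[of I a]
    by (intro left_ideal_sum[OF N] left_ideal_scale[OF N] mult_eval_poly_closed[OF N right]) auto
  finally have "eval_poly a p \<in> ?N" .
  moreover have "p \<noteq> 0"
    unfolding p_def Q_def using S c0 by (rule sum_partial_products_nonzero)
  ultimately obtain e where "a ^ e \<in> ?N"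
    using power_in_of_polynomial_in[OF N right subset_left_poly inv] by blast
  then show "integral_elt I a"
    by (rule integral_elt_of_power_in_left_poly[OF I])
qed

end

section \<open>Comparison of the two radicals\<close>

lemma integrally_closed_jacobson_radical: "integrally_closed (jacobson_radical I)"
proof -
  have "L \<subseteq> jacobson_radical I" if "left_ideal L" "integral_over (jacobson_radical I) L" for L
    using integral_subset_jacobson_radical[OF that] by (simp only: jacobson_radical_idem)
  then show ?thesis
    using left_ideal_jacobson_radical unfolding integrally_closed_def by fastforce
qed

lemma integral_radical_eq_jacobson_radical:
  fixes I :: "'r::{ring, monoid_mult} set"
  assumes int: "\<And>J :: 'r set. left_ideal J \<Longrightarrow> integral_over J (jacobson_radical J)"
  shows "integral_radical I = jacobson_radical I"
proof
  show "integral_radical I \<subseteq> jacobson_radical I"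
    unfolding integral_radical_def
    using integrally_closed_jacobson_radical subset_jacobson_radical by blast
  show "jacobson_radical I \<subseteq> integral_radical I"
    unfolding integral_radical_def
  proof (rule Inter_greatest, clarify)
    fix J x
    assume J: "integrally_closed J" "I \<subseteq> J" and x: "x \<in> jacobson_radical I"
    have "jacobson_radical J = J"
      using J(1) int[of J] left_ideal_jacobson_radical[of J] subset_jacobson_radical[of J]
      unfolding integrally_closed_def by blast
    then show "x \<in> J"
      using jacobson_radical_mono[OF J(2)] x by blast
  qed
qed

theorem theorem4p9:
  fixes scale :: "'k::field \<Rightarrow> 'r::{ring, monoid_mult} \<Rightarrow> 'r"
    and I :: "'r set"
  assumes "k_algebra scale"
    and "k_algebra.cardinal_dim scale <o |UNIV :: 'k set|"
    and "left_ideal I"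
  shows "(left_ideal (jacobson_radical I) \<and>
          integral_over I (jacobson_radical I) \<and>
          (\<forall>L. left_ideal L \<and> integral_over I L \<longrightarrow> L \<subseteq> jacobson_radical I)) \<and>
         integral_radical I = jacobson_radical I"
proof -
  have int: "integral_over J (jacobson_radical J)" if "left_ideal J" for J :: "'r set"
    using k_algebra.integral_over_jacobson_radical[OF assms(1,2) that] .
  show ?thesis
    using left_ideal_jacobson_radical int[OF assms(3)] integral_subset_jacobson_radical
      integral_radical_eq_jacobson_radical[OF int] by blast
qed

end
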